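(* Let $G=(V,E)$ be a connected graph, $c:V\to\mathbb{N}$, and $0<\epsilon<1$. The Iterative Rounding algorithm (run SolveIP2$(G,\emptyset,c)$) approximates PDBEP with approximation factor $3/(1-\epsilon)^2$: its output $E'$ is a feasible PDBEP solution and $\mathrm{OPT}\le \frac{3}{(1-\epsilon)^2}|E'|$, where $\mathrm{OPT}$ is the maximum cardinality of a feasible PDBEP solution.
   Context: PDBEP: given $G=(V,E)$ and $c:V\to\mathbb{N}$, $E'\subseteq E$ is feasible if for every $(u,v)\in E'$, $d'_u\le c_u$ or $d'_v\le c_v$, with $d'_x$ the degree of $x$ in $(V,E')$. For a graph $H=(V_H,E_H)$, $f:V_H\to\{0,1,2,\dots\}$ and $C\subseteq V_H$, LP2$(H,f,C)$ is: maximize $2\sum_{e\in E_H}y_e-(1+\epsilon)\sum_{v\in V_H}z_v$ subject to $\sum_{e\in\delta(v)}y_e\le f_v+z_v$ for $v\in V_H\setminus C$; $\sum_{e\in\delta(v)}y_e\le f_v$ for $v\in C$; $z_v\ge0$; $0\le y_e\le1$ ($\delta(v)$ = edges of $H$ incident on $v$). The recursive procedure SolveIP2$(H,C,f)$: if $E_H=\emptyset$ return $\emptyset$. Delete all isolated vertices. Compute an optimal extreme point solution $(y,z)$ of LP2$(H,f,C)$. If some $e\in E_H$ has $y_e=0$, return SolveIP2$((V_H,E_H\setminus\{e\}),C,f)$. Otherwise choose an edge $e=(u,v)$ with $y_e\ge 1/2$ and name its endpoints so that $f_v>0$ and $z_v=0$ (such a choice always exists); set $f_v:=f_v-1$, $f_u:=\max\{f_u-1,0\}$,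 $C:=C\cup\{v\}$, and return SolveIP2$((V_H,E_H\setminus\{e\}),C,f)\cup\{e\}$. *)

theory Defs
  imports "HOL-Analysis.Analysis"
begin

text \<open>Finite simple undirected graphs on a vertex set \<open>V\<close> contained in a finite type; an edge is a
  two-element set of vertices.\<close>

definition simple_graph :: "'a::finite set \<Rightarrow> 'a set set \<Rightarrow> bool" where
  "simple_graph V E \<longleftrightarrow> (\<forall>e\<in>E. e \<subseteq> V \<and> card e = 2)"

definition connected_graph :: "'a::finite set \<Rightarrow> 'a set set \<Rightarrow> bool" where
  "connected_graph V E \<longleftrightarrow> simple_graph V E \<and> (\<forall>u\<in>V. \<forall>v\<in>V. (u, v) \<in> {(a, b). {a, b} \<in> E}\<^sup>*)"

definition incident :: "'a set set \<Rightarrow> 'a \<Rightarrow> 'a set set" where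
  "incident E v = {e \<in> E. v \<in> e}"

definition degree :: "'a set set \<Rightarrow> 'a \<Rightarrow> nat" where
  "degree E v = card (incident E v)"

definition pdbep_feasible :: "'a::finite set set \<Rightarrow> ('a \<Rightarrow> nat) \<Rightarrow> 'a set set \<Rightarrow> bool" where
  "pdbep_feasible E c E' \<longleftrightarrow>
     E' \<subseteq> E \<and> (\<forall>u v. {u, v} \<in> E' \<longrightarrow> degree E' u \<le> c u \<or> degree E' v \<le> c v)"

definition pdbep_opt :: "'a::finite set set \<Rightarrow> ('a \<Rightarrow> nat) \<Rightarrow> nat" where
  "pdbep_opt E c = Max {card E' | E'. pdbep_feasible E c E'}"

text \<open>The LP has variables \<open>y\<^sub>e\<close> for \<open>e \<in> E\<close> and \<open>z\<^sub>v\<close> for \<open>v \<in> V\<close> only.  They live in the fixed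
  Euclidean space with a coordinate for every set of vertices and every vertex of the type;
  the superfluous coordinates are pinned to 0, so that the extreme points are those of the LP
  polyhedron in \<open>\<real>\<^sup>E \<times> \<real>\<^sup>V\<close>.\<close>

type_synonym 'a lp_point = "(real ^ 'a set) \<times> (real ^ 'a)"

definition lp2_feasible ::
  "'a::finite set \<Rightarrow> 'a set set \<Rightarrow> ('a \<Rightarrow> nat) \<Rightarrow> 'a set \<Rightarrow> 'a lp_point set" where
  "lp2_feasible V E f C = {(y, z).
     (\<forall>v\<in>V - C. (\<Sum>e\<in>incident E v. y $ e) \<le> real (f v) + z $ v) \<and>
     (\<forall>v\<in>V \<inter> C. (\<Sum>e\<in>incident E v. y $ e) \<le> real (f v)) \<and>
     (\<forall>v\<in>V. 0 \<le> z $ v) \<and>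
     (\<forall>e\<in>E. 0 \<le> y $ e \<and> y $ e \<le> 1) \<and>
     (\<forall>e. e \<notin> E \<longrightarrow> y $ e = 0) \<and> (\<forall>v. v \<notin> V \<longrightarrow> z $ v = 0)}"

definition lp2_objective ::
  "real \<Rightarrow> 'a::finite set \<Rightarrow> 'a set set \<Rightarrow> 'a lp_point \<Rightarrow> real" where
  "lp2_objective \<epsilon> V E = (\<lambda>(y, z). 2 * (\<Sum>e\<in>E. y $ e) - (1 + \<epsilon>) * (\<Sum>v\<in>V. z $ v))"

definition lp2_optimal_extreme ::
  "real \<Rightarrow> 'a::finite set \<Rightarrow> 'a set set \<Rightarrow> ('a \<Rightarrow> nat) \<Rightarrow> 'a set \<Rightarrow> 'a lp_point \<Rightarrow> bool" where
  "lp2_optimal_extreme \<epsilon> V E f C p \<longleftrightarrow>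
     p extreme_point_of (lp2_feasible V E f C) \<and>
     (\<forall>q\<in>lp2_feasible V E f C. lp2_objective \<epsilon> V E q \<le> lp2_objective \<epsilon> V E p)"

definition non_isolated :: "'a set \<Rightarrow> 'a set set \<Rightarrow> 'a set" where
  "non_isolated V E = {v \<in> V. incident E v \<noteq> {}}"

text \<open>\<open>solveIP2 \<epsilon> V E C f S\<close>: some run of the recursive procedure on the graph \<open>(V, E)\<close> with
  arguments \<open>C\<close> and \<open>f\<close> returns \<open>S\<close>.  It is a relation because the optimal extreme point, the edge
  and the naming of its endpoints are arbitrary choices.  Subtraction on \<^typ>\<open>nat\<close> truncates,
  so \<open>f u - 1\<close> is \<open>max {f\<^sub>u - 1, 0}\<close>.\<close>

inductive solveIP2 ::
  "real \<Rightarrow> 'a::finite set \<Rightarrow> 'a set set \<Rightarrow> 'a set \<Rightarrow> ('a \<Rightarrow> nat) \<Rightarrow> 'a set set \<Rightarrow> bool"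
  for \<epsilon> :: real where
  empty: "solveIP2 \<epsilon> V {} C f {}"
| delete:
    "\<lbrakk> E \<noteq> {}; W = non_isolated V E;
       lp2_optimal_extreme \<epsilon> W E f C (y, z);
       e \<in> E; y $ e = 0;
       solveIP2 \<epsilon> W (E - {e}) C f S \<rbrakk>
     \<Longrightarrow> solveIP2 \<epsilon> V E C f S"
| pick:
    "\<lbrakk> E \<noteq> {}; W = non_isolated V E;
       lp2_optimal_extreme \<epsilon> W E f C (y, z);
       \<forall>e\<in>E. y $ e \<noteq> 0;
       e \<in> E; e = {u, v}; y $ e \<ge> 1 / 2; f v > 0; z $ v = 0;
       solveIP2 \<epsilon> W (E - {e}) (insert v C) (f(v := f v - 1, u := f u - 1)) S \<rbrakk>
     \<Longrightarrow> solveIP2 \<epsilon> V E C f (insert e S)"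

end

theory Submission
  imports Defs
begin

text \<open>A feasible edge set \<open>F\<close> together with its degree excesses is a point of the LP of value at least
  \<open>(1 - \<epsilon>) |F|\<close>, while every picked edge lowers the LP optimum by at most 3 and every deleted edge
  leaves it unchanged; hence the output \<open>S\<close> satisfies \<open>(1 - \<epsilon>) OPT \<le> 3 |S|\<close>.  Feasibility holds
  because a vertex in \<open>C\<close> never exceeds its remaining bound.  The procedure cannot get stuck: at an
  extreme point with all \<open>y\<^sub>e \<in> (0, 1/2)\<close> there are at least \<open>|E|\<close> vertices with tight bound,
  and each of them, the bound being a positive integer, has degree at least 3, which exceeds
  the degree sum \<open>2 |E|\<close>.\<close>

section \<open>Weighted handshaking\<close>

text \<open>Double counting of incident pairs: an edge is met once for each of its endpoints in
  \<open>A\<close>. Leaving \<open>A\<close> free allows sums over only the tight or only the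
  violated vertices.\<close>

lemma sum_incident_swap:
  fixes E :: "'a::finite set set" and g :: "'a set \<Rightarrow> 'b::comm_semiring_1"
  shows "(\<Sum>v\<in>A. \<Sum>e\<in>incident E v. g e) = (\<Sum>e\<in>E. of_nat (card (e \<inter> A)) * g e)"
proof -
  have "(\<Sum>v\<in>A. \<Sum>e\<in>incident E v. g e) = (\<Sum>e\<in>E. \<Sum>v\<in>{v\<in>A. v \<in> e}. g e)"
    unfolding incident_def by (rule sum.swap_restrict) auto
  also have "\<dots> = (\<Sum>e\<in>E. of_nat (card (e \<inter> A)) * g e)"
    by (intro sum.cong refl) (auto simp: Int_def conj_commute)
  finally show ?thesis .
qed

lemma sum_degree:
  fixes E :: "'a::finite set set"
  shows "(\<Sum>v\<in>A. degree E v) = (\<Sum>e\<in>E. card (e \<inter> A))"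
  using sum_incident_swap[where g = "\<lambda>_. 1::nat"] by (simp add: degree_def)

lemma incident_remove_edge: "incident (E - {e}) w = incident E w - {e}"
  by (auto simp: incident_def)

lemma incident_subset: "incident E w \<subseteq> E"
  by (auto simp: incident_def)

lemma simple_graph_non_isolated:
  assumes "simple_graph V E" "F \<subseteq> E" shows "simple_graph (non_isolated V E) F"
  using assms by (fastforce simp: simple_graph_def non_isolated_def incident_def)

section \<open>The linear program\<close>

lemma lp2_feasible_iff:
  "(y, z) \<in> lp2_feasible V E f C \<longleftrightarrow>
     (\<forall>v\<in>V - C. (\<Sum>e\<in>incident E v. y $ e) \<le> real (f v) + z $ v) \<and>
     (\<forall>v\<in>V \<inter> C. (\<Sum>e\<in>incident E v. y $ e) \<le> real (f v)) \<and>
     (\<forall>v\<in>V. 0 \<le> z $ v) \<and>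
     (\<forall>e\<in>E. 0 \<le> y $ e \<and> y $ e \<le> 1) \<and>
     (\<forall>e. e \<notin> E \<longrightarrow> y $ e = 0) \<and> (\<forall>v. v \<notin> V \<longrightarrow> z $ v = 0)"
  by (simp add: lp2_feasible_def)

section \<open>Polyhedral structure of the linear program and existence of optimal extreme
  points\<close>

lemma sum_if_mult:
  fixes A :: "'b::finite set" and k :: "'c::semiring_0"
  shows "(\<Sum>i\<in>UNIV. (if i \<in> A then k else 0) * g i) = k * sum g A"
  by (simp add: if_distrib[of "\<lambda>t. t * _"] sum.If_cases sum_distrib_left cong: if_cong)

text \<open>As a linear functional the objective is continuous, and its optimal points lie on a
  supporting hyperplane.\<close>

lemma lp2_objective_inner:
  "lp2_objective \<epsilon> V E p =
     ((\<chi> e. if e \<in> E then 2 else 0), (\<chi> v. if v \<in> V then - (1 + \<epsilon>) else 0)) \<bullet> p"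
  by (cases p) (simp add: lp2_objective_def inner_vec_def sum_if_mult del: minus_add_distrib)

text \<open>Half-spaces and hyperplanes, so that closedness and convexity can be checked one
  constraint at a time.\<close>

lemma lp2_feasible_Int:
  "lp2_feasible V E f C =
     (\<Inter>v\<in>V - C. {p. (\<Sum>e\<in>incident E v. fst p $ e) \<le> real (f v) + snd p $ v}) \<inter>
     (\<Inter>v\<in>V \<inter> C. {p. (\<Sum>e\<in>incident E v. fst p $ e) \<le> real (f v)}) \<inter>
     (\<Inter>v\<in>V. {p. 0 \<le> snd p $ v}) \<inter>
     (\<Inter>e\<in>E. {p. 0 \<le> fst p $ e} \<inter> {p. fst p $ e \<le> 1}) \<inter>
     (\<Inter>e\<in>- E. {p. fst p $ e = 0}) \<inter> (\<Inter>v\<in>- V. {p. snd p $ v = 0})"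
  by (auto simp: lp2_feasible_def)

lemma closed_lp2_feasible: "closed (lp2_feasible V E f C)"
  unfolding lp2_feasible_Int
  by (intro closed_Int closed_INT ballI closed_Collect_le closed_Collect_eq continuous_intros)

lemma convex_lp2_feasible: "convex (lp2_feasible V E f C)"
proof -
  have *: "convex {p::'a lp_point. L p \<le> b}" "convex {p::'a lp_point. L p = b}"
    if "linear L" for L :: "'a lp_point \<Rightarrow> real" and b
    using that convex_linear_vimage[OF that, of "{..b}"] convex_linear_vimage[OF that, of "{b}"]
    by (auto simp: vimage_def)
  \<comment> \<open>\<open>a = 1\<close> and \<open>a = 0\<close> serve the degree constraints
    outside and inside \<open>C\<close>; the factor -1 turns lower bounds into upper bounds.\<close>
  have l: "linear (\<lambda>p::'a lp_point. (\<Sum>e\<in>A. fst p $ e) - a * snd p $ v)"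
    "linear (\<lambda>p::'a lp_point. a * fst p $ e)" "linear (\<lambda>p::'a lp_point. a * snd p $ v)"
    for A a e v
    by (auto intro!: linearI simp: sum.distrib sum_distrib_left algebra_simps)
  show ?thesis
    unfolding lp2_feasible_Int
    using *(1)[OF l(1)[of _ 1]] *(1)[OF l(1)[of _ 0]] *(1)[OF l(2)[of "-1"], of _ 0] *(1)[OF l(2)[of "1"]]
      *(1)[OF l(3)[of "-1"], of _ 0] *(2)[OF l(2)[of 1]] *(2)[OF l(3)[of 1]]
    by (intro convex_Int convex_INT) (simp_all add: algebra_simps)
qed

text \<open>Capping the slack variables at the number of edges keeps a point feasible, so the
  unbounded directions of the polyhedron do not matter.\<close>

lemma lp2_cap_slack:
  assumes "(y, z) \<in> lp2_feasible V E f C" and "\<epsilon> > -1"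
  defines "z' \<equiv> \<chi> v. min (z $ v) (real (card E))"
  shows "(y, z') \<in> lp2_feasible V E f C"
    and "lp2_objective \<epsilon> V E (y, z) \<le> lp2_objective \<epsilon> V E (y, z')"
    and "v \<in> V \<Longrightarrow> z $ v > real (card E) \<Longrightarrow>
      lp2_objective \<epsilon> V E (y, z) < lp2_objective \<epsilon> V E (y, z')"
proof -
  have y: "0 \<le> y $ e \<and> y $ e \<le> 1" if "e \<in> E" for e
    using assms(1) that by (simp add: lp2_feasible_iff)
  have "(\<Sum>e\<in>incident E v. y $ e) \<le> real (card E)" for v
  proof -
    have "(\<Sum>e\<in>incident E v. y $ e) \<le> (\<Sum>e\<in>incident E v. 1)"
      using y incident_subset[of E v] by (intro sum_mono) auto
    also have "\<dots> \<le> real (card E)"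
      using card_mono[OF finite incident_subset[of E v]] by simp
    finally show ?thesis .
  qed
  then show "(y, z') \<in> lp2_feasible V E f C"
    using assms(1) by (auto simp: lp2_feasible_iff z'_def min_def add_increasing)
  show "lp2_objective \<epsilon> V E (y, z) \<le> lp2_objective \<epsilon> V E (y, z')"
    using assms(2) by (auto simp: lp2_objective_def z'_def intro!: mult_left_mono sum_mono)
  assume "v \<in> V" "z $ v > real (card E)"
  then have "(\<Sum>v\<in>V. z' $ v) < (\<Sum>v\<in>V. z $ v)"
    by (intro sum_strict_mono_ex1) (auto simp: z'_def intro!: bexI[of _ v])
  then show "lp2_objective \<epsilon> V E (y, z) < lp2_objective \<epsilon> V E (y, z')"
    using assms(2) by (simp add: lp2_objective_def)
qed

lemma lp2_bounded_slack:
  fixes V :: "'a::finite set"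
  shows "bounded (lp2_feasible V E f C \<inter> {p. \<forall>v\<in>V. snd p $ v \<le> B})"
proof -
  \<comment> \<open>\<open>max 0 B\<close> keeps the box large enough for the zero coordinates
    outside \<open>V\<close> when \<open>B\<close> is negative.\<close>
  have "lp2_feasible V E f C \<inter> {p. \<forall>v\<in>V. snd p $ v \<le> B} \<subseteq>
      cbox (0::'a lp_point) ((\<chi> e. 1), (\<chi> v. max 0 B))"
  proof
    fix p assume p: "p \<in> lp2_feasible V E f C \<inter> {p. \<forall>v\<in>V. snd p $ v \<le> B}"
    obtain y z where yz: "p = (y, z)" by (cases p)
    have "0 \<le> y $ e \<and> y $ e \<le> 1" for e
      using p by (cases "e \<in> E") (auto simp: yz lp2_feasible_iff)
    moreover have "0 \<le> z $ v \<and> z $ v \<le> max 0 B" for v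
      using p by (cases "v \<in> V") (auto simp: yz lp2_feasible_iff)
    ultimately show "p \<in> cbox 0 ((\<chi> e. 1), (\<chi> v. max 0 B))"
      by (simp add: yz zero_prod_def cbox_Pair_eq mem_box_cart)
  qed
  then show ?thesis
    using bounded_cbox bounded_subset by blast
qed

text \<open>The optimal points form a nonempty compact face, and the extreme points of a face are
  extreme points of the whole polyhedron.\<close>

lemma lp2_optimal_extreme_exists:
  fixes V :: "'a::finite set"
  assumes "\<epsilon> > -1"
  shows "\<exists>p. lp2_optimal_extreme \<epsilon> V E f C p"
proof -
  let ?P = "lp2_feasible V E f C" and ?o = "lp2_objective \<epsilon> V E"
  let ?B = "{p::'a lp_point. \<forall>v\<in>V. snd p $ v \<le> real (card E)}"
  have "?B = (\<Inter>v\<in>V. {p::'a lp_point. snd p $ v \<le> real (card E)})" by auto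
  moreover have "closed \<dots>"
    by (intro closed_INT ballI closed_Collect_le continuous_intros)
  ultimately have "closed ?B" by argo
  then have comp: "compact (?P \<inter> ?B)"
    by (simp add: compact_eq_bounded_closed lp2_bounded_slack closed_lp2_feasible closed_Int)
  have "(0, 0) \<in> ?P \<inter> ?B" by (simp add: lp2_feasible_iff)
  then have ne: "?P \<inter> ?B \<noteq> {}" by blast
  have cont: "continuous_on A ?o" for A
    unfolding lp2_objective_inner by (intro continuous_intros)
  obtain m where m: "m \<in> ?P" and max_B: "\<forall>q\<in>?P \<inter> ?B. ?o q \<le> ?o m"
    using continuous_attains_sup[OF comp ne cont] by blast
  \<comment> \<open>Capping the slacks moves any feasible point into the compact part without
    lowering its value, so the maximum found there is global.\<close>
  have max: "?o q \<le> ?o m" if q: "q \<in> ?P" for q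
  proof -
    obtain y z where yz: "q = (y, z)" by (cases q)
    note cap = lp2_cap_slack[OF q[unfolded yz] assms]
    show ?thesis
      using cap(2) max_B[rule_format, of "(y, \<chi> v. min (z $ v) (real (card E)))"] cap(1)
      by (simp add: yz)
  qed
  define F where "F = ?P \<inter> {q. ?o q = ?o m}"
  have face: "F face_of ?P"
    unfolding F_def lp2_objective_inner
    by (rule face_of_Int_supporting_hyperplane_le[OF convex_lp2_feasible])
      (use max in \<open>simp add: lp2_objective_inner\<close>)
  \<comment> \<open>A point with a slack above \<open>card E\<close> is strictly improved by
    capping, hence not optimal.\<close>
  have "F \<subseteq> ?P \<inter> ?B"
  proof
    fix q assume q: "q \<in> F"
    obtain y z where yz: "q = (y, z)" by (cases q)
    have q': "(y, z) \<in> ?P" using q by (simp add: F_def yz)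
    have "\<not> z $ v > real (card E)" if "v \<in> V" for v
      using lp2_cap_slack(1)[OF q' assms] lp2_cap_slack(3)[OF q' assms that] max q
      by (force simp: F_def yz)
    then show "q \<in> ?P \<inter> ?B" using q' by (auto simp: yz not_less)
  qed
  then have "F = ?P \<inter> ?B \<inter> F" by blast
  moreover have "closed F"
    unfolding F_def by (intro closed_Int closed_lp2_feasible closed_Collect_eq cont continuous_intros)
  then have "compact (?P \<inter> ?B \<inter> F)" by (rule compact_Int_closed[OF comp])
  ultimately have "compact F" by argo
  moreover have "F \<noteq> {}" using m by (auto simp: F_def)
  ultimately obtain p where "p extreme_point_of F"
    using extreme_point_exists_convex face_of_imp_convex[OF face] by blast
  then have "p extreme_point_of ?P" "p \<in> F"
    using extreme_point_of_face[OF face] by auto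
  then have "lp2_optimal_extreme \<epsilon> V E f C p"
    using max by (simp add: lp2_optimal_extreme_def F_def)
  then show ?thesis ..
qed

section \<open>Extreme points: tight vertices, an edge of value at least 1/2, and its
  endpoints\<close>

text \<open>Otherwise \<open>p\<close> would be the midpoint of a proper segment in
  \<open>S\<close>.\<close>

lemma extreme_point_perturb:
  assumes "p extreme_point_of S" "p + d \<in> S" "p - d \<in> S"
  shows "d = (0::'v::real_vector)"
proof (rule ccontr)
  assume "d \<noteq> 0"
  have "p = midpoint (p - d) (p + d)"
    by (simp add: midpoint_def scaleR_2[symmetric])
  moreover have "p - d \<noteq> p + d"
  proof
    assume "p - d = p + d"
    then have "(p + d) - (p - d) = 0" by simp
    then have "2 *\<^sub>R d = 0" by (simp add: scaleR_2)
    then show False using \<open>d \<noteq> 0\<close> by simp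
  qed
  ultimately have "p \<in> open_segment (p - d) (p + d)"
    using midpoint_in_open_segment by metis
  then show False using assms by (auto simp: extreme_point_of_def)
qed

text \<open>Dimension count: the incidence vectors of \<open>T\<close> span a proper subspace of the
  coordinate space of \<open>E\<close>, which leaves a nonzero vector there orthogonal to all of
  them.\<close>

lemma underdetermined_incidence_system:
  fixes E :: "'a::finite set set"
  assumes "card T < card E"
  obtains w :: "real ^ 'a set" where "w \<noteq> 0" "\<And>e. e \<notin> E \<Longrightarrow> w $ e = 0"
    "\<And>v. v \<in> T \<Longrightarrow> (\<Sum>e\<in>incident E v. w $ e) = 0"
proof -
  define a :: "'a \<Rightarrow> real ^ 'a set" where "a v = (\<Sum>e\<in>incident E v. axis e 1)" for v
  define B :: "(real ^ 'a set) set" where "B = (\<lambda>e. axis e 1) ` E"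
  have "inj_on (\<lambda>e. axis e (1::real)) E"
    by (auto simp: inj_on_def axis_eq_axis)
  then have "card B = card E" by (simp add: B_def card_image)
  moreover have "independent B"
    by (rule independent_mono[OF independent_Basis]) (auto simp: B_def axis_in_Basis_iff)
  ultimately have dimB: "dim (span B) = card E"
    by (simp add: dim_eq_card_independent)
  have "a ` T \<subseteq> span B"
    unfolding a_def B_def using incident_subset[of E]
    by (intro image_subsetI span_sum span_base imageI) blast
  then have "span (a ` T) \<subseteq> span B"
    by (simp add: span_minimal)
  moreover have "dim (span (a ` T)) \<le> card T"
    using dim_le_card[of "span (a ` T)" "a ` T"] card_image_le[of T a] by simp
  then have "span (a ` T) \<noteq> span B" using assms dimB by force
  ultimately obtain w where w: "w \<noteq> 0" "w \<in> span B" "\<And>x. x \<in> span (a ` T) \<Longrightarrow> orthogonal w x"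
    using orthogonal_to_subspace_exists_gen[of "a ` T" B] by blast
  have "w $ e = 0" if "e \<notin> E" for e
  proof -
    have "subspace {x::real ^ 'a set. x $ e = 0}" by (auto simp: subspace_def)
    moreover have "B \<subseteq> {x. x $ e = 0}" using that by (auto simp: B_def axis_def)
    ultimately show ?thesis using w(2) span_minimal by blast
  qed
  moreover have "(\<Sum>e\<in>incident E v. w $ e) = 0" if "v \<in> T" for v
  proof -
    have "w \<bullet> a v = 0" using w(3) that by (auto simp: orthogonal_def span_base)
    then show ?thesis by (simp add: a_def inner_sum_right inner_axis)
  qed
  ultimately show thesis using that w(1) by blast
qed

text \<open>By continuity at \<open>t = 0\<close>, a strict constraint survives small steps in both
  directions.\<close>

lemma eventually_perturbed_le:
  assumes "a < (b::real)"
  shows "\<forall>\<^sub>F t in nhds 0. a + t * k \<le> b + t * l"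
proof -
  have "((\<lambda>t. (b + t * l) - (a + t * k)) \<longlongrightarrow> (b + 0 * l) - (a + 0 * k)) (nhds 0)"
    by (intro tendsto_intros filterlim_ident)
  then have "\<forall>\<^sub>F t in nhds 0. 0 < (b + t * l) - (a + t * k)"
    using assms by (intro order_tendstoD(1)) auto
  then show ?thesis by eventually_elim simp
qed

text \<open>A nonzero edge vector with vanishing sums at all tight vertices could be added to and
  subtracted from the extreme point, the slacks following at the vertices with \<open>z\<^sub>v > 0\<close>.\<close>

lemma lp2_extreme_card_le_tight:
  fixes V :: "'a::finite set"
  assumes ext: "(y, z) extreme_point_of lp2_feasible V E f C"
    and frac: "\<forall>e\<in>E. 0 < y $ e \<and> y $ e < 1"
  shows "card E \<le> card {v\<in>V. (\<Sum>e\<in>incident E v. y $ e) = real (f v)}"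
proof (rule ccontr)
  let ?T = "{v\<in>V. (\<Sum>e\<in>incident E v. y $ e) = real (f v)}"
  assume "\<not> card E \<le> card ?T"
  then have less: "card ?T < card E" by simp
  obtain w :: "real ^ 'a set" where w: "w \<noteq> 0" "\<And>e. e \<notin> E \<Longrightarrow> w $ e = 0"
    "\<And>v. v \<in> ?T \<Longrightarrow> (\<Sum>e\<in>incident E v. w $ e) = 0"
    by (rule underdetermined_incidence_system[OF less]) (rule that; blast)
  \<comment> \<open>Where a slack is positive and usable, it absorbs the change of the edge sum; all
    other slacks stay fixed.\<close>
  define x :: "real ^ 'a" where
    "x = (\<chi> v. if v \<in> V - C \<and> z $ v > 0 then \<Sum>e\<in>incident E v. w $ e else 0)"
  have feas: "(y, z) \<in> lp2_feasible V E f C"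
    using ext by (simp add: extreme_point_of_def)
  have sum_eq: "(\<Sum>e\<in>incident E v. (y + t *\<^sub>R w) $ e) =
      (\<Sum>e\<in>incident E v. y $ e) + t * (\<Sum>e\<in>incident E v. w $ e)" for v t
    by (simp add: sum.distrib sum_distrib_left)
  have ev: "\<forall>\<^sub>F t in nhds 0. (y + t *\<^sub>R w, z + t *\<^sub>R x) \<in> lp2_feasible V E f C"
    unfolding lp2_feasible_iff sum_eq
  proof (intro eventually_conj eventually_ball_finite ballI finite eventually_all_finite)
    fix v assume v: "v \<in> V - C"
    have le: "(\<Sum>e\<in>incident E v. y $ e) \<le> real (f v) + z $ v" "0 \<le> z $ v"
      using feas v by (auto simp: lp2_feasible_iff)
    \<comment> \<open>Respectively: the edge sum does not move, both sides move equally, or the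
      constraint is strict.\<close>
    consider "v \<in> ?T" | "z $ v > 0" | "z $ v = 0" "(\<Sum>e\<in>incident E v. y $ e) < real (f v)"
      using le v by force
    then show "\<forall>\<^sub>F t in nhds 0. (\<Sum>e\<in>incident E v. y $ e) + t * (\<Sum>e\<in>incident E v. w $ e)
        \<le> real (f v) + (z + t *\<^sub>R x) $ v"
    proof cases
      case 1
      then show ?thesis using w(3)[OF 1] le by (simp add: x_def)
    next
      case 2
      then show ?thesis using v le by (simp add: x_def)
    next
      case 3
      then show ?thesis
        using eventually_perturbed_le[OF 3(2), of "\<Sum>e\<in>incident E v. w $ e" 0]
        by (simp add: x_def)
    qed
  next
    fix v assume v: "v \<in> V \<inter> C"
    have le: "(\<Sum>e\<in>incident E v. y $ e) \<le> real (f v)"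
      using feas v by (auto simp: lp2_feasible_iff)
    show "\<forall>\<^sub>F t in nhds 0. (\<Sum>e\<in>incident E v. y $ e) + t * (\<Sum>e\<in>incident E v. w $ e)
        \<le> real (f v)"
    proof (cases "v \<in> ?T")
      case True
      then show ?thesis using w(3)[OF True] le by simp
    next
      case False
      then have "(\<Sum>e\<in>incident E v. y $ e) < real (f v)" using le v by auto
      from eventually_perturbed_le[OF this, of _ 0] show ?thesis by simp
    qed
  next
    fix v assume "v \<in> V"
    then have "0 \<le> z $ v" using feas by (simp add: lp2_feasible_iff)
    then show "\<forall>\<^sub>F t in nhds 0. 0 \<le> (z + t *\<^sub>R x) $ v"
      using eventually_perturbed_le[of 0 "z $ v" 0 "x $ v"]
      by (cases "z $ v = 0") (auto simp: x_def)
  next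
    fix e assume "e \<in> E"
    then have "0 < y $ e" "y $ e < 1" using frac by auto
    then show "\<forall>\<^sub>F t in nhds 0. 0 \<le> (y + t *\<^sub>R w) $ e" "\<forall>\<^sub>F t in nhds 0. (y + t *\<^sub>R w) $ e \<le> 1"
      using eventually_perturbed_le[of 0 "y $ e" 0 "w $ e"]
        eventually_perturbed_le[of "y $ e" 1 "w $ e" 0] by simp_all
  next
    fix e
    show "\<forall>\<^sub>F t in nhds 0. e \<notin> E \<longrightarrow> (y + t *\<^sub>R w) $ e = 0"
      using feas w(2) by (auto simp: lp2_feasible_iff)
  next
    fix v
    show "\<forall>\<^sub>F t in nhds 0. v \<notin> V \<longrightarrow> (z + t *\<^sub>R x) $ v = 0"
      using feas by (auto simp: lp2_feasible_iff x_def)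
  qed
  then obtain r where r: "r > 0"
    "\<And>t. dist t 0 < r \<Longrightarrow> (y + t *\<^sub>R w, z + t *\<^sub>R x) \<in> lp2_feasible V E f C"
    unfolding eventually_nhds_metric by blast
  have "(y, z) + (r / 2) *\<^sub>R (w, x) \<in> lp2_feasible V E f C"
    "(y, z) - (r / 2) *\<^sub>R (w, x) \<in> lp2_feasible V E f C"
    using r(2)[of "r / 2"] r(2)[of "- (r / 2)"] r(1) by (simp_all add: dist_real_def)
  then have "(r / 2) *\<^sub>R (w, x) = 0"
    by (rule extreme_point_perturb[OF ext])
  then show False using r(1) w(1) by (simp add: zero_prod_def)
qed

text \<open>If all values were below 1/2, every tight vertex would have degree at least 3. With
  \<open>T\<close> the tight vertices, the degree sum gives
  \<open>3 |T| \<le> 2 |E| \<le> 2 |T|\<close>, which leaves no edges.\<close>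

lemma lp2_extreme_half_edge:
  fixes V :: "'a::finite set"
  assumes ext: "(y, z) extreme_point_of lp2_feasible V E f C"
    and pos: "\<forall>e\<in>E. y $ e \<noteq> 0" and graph: "simple_graph V E" and "E \<noteq> {}"
    and cover: "\<forall>v\<in>V. incident E v \<noteq> {}"
  shows "\<exists>e\<in>E. y $ e \<ge> 1 / 2"
proof (rule ccontr)
  assume "\<not> (\<exists>e\<in>E. y $ e \<ge> 1 / 2)"
  then have half: "y $ e < 1 / 2" if "e \<in> E" for e using that by force
  have feas: "(y, z) \<in> lp2_feasible V E f C"
    using ext by (simp add: extreme_point_of_def)
  have pos': "0 < y $ e" if "e \<in> E" for e
    using feas pos that by (force simp: lp2_feasible_iff less_le)
  let ?T = "{v\<in>V. (\<Sum>e\<in>incident E v. y $ e) = real (f v)}"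
  have deg: "3 \<le> degree E v" if v: "v \<in> ?T" for v
  proof -
    have ne: "incident E v \<noteq> {}" using v cover by auto
    have "0 < (\<Sum>e\<in>incident E v. y $ e)"
      using ne pos' incident_subset[of E v] by (intro sum_pos) auto
    \<comment> \<open>A positive edge sum that equals the natural number \<open>f v\<close> is at
      least 1.\<close>
    then have "1 \<le> (\<Sum>e\<in>incident E v. y $ e)" using v by auto
    also have "\<dots> < (\<Sum>e\<in>incident E v. 1 / 2)"
      using ne half incident_subset[of E v] by (intro sum_strict_mono) auto
    also have "\<dots> = real (degree E v) / 2" by (simp add: degree_def)
    finally show ?thesis by simp
  qed
  have "3 * card ?T = (\<Sum>v\<in>?T. 3)" by simp
  also have "\<dots> \<le> (\<Sum>v\<in>?T. degree E v)" using deg by (intro sum_mono) auto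
  also have "\<dots> = (\<Sum>e\<in>E. card (e \<inter> ?T))" by (rule sum_degree)
  also have "\<dots> \<le> (\<Sum>e\<in>E. 2)"
    using graph by (intro sum_mono) (metis card_mono finite inf_le1 simple_graph_def)
  also have "\<dots> \<le> 2 * card ?T"
    using lp2_extreme_card_le_tight[OF ext] pos' half by force
  finally have "card ?T = 0" by linarith
  moreover have "card E \<le> card ?T"
    using lp2_extreme_card_le_tight[OF ext] pos' half by force
  ultimately have "card E = 0" by linarith
  then show False using \<open>E \<noteq> {}\<close> by simp
qed

text \<open>If both endpoints had positive slack, lowering \<open>y\<^sub>e\<close> and both slacks by the same amount
  would gain \<open>2 (1 + \<epsilon>) - 2 > 0\<close> per unit.\<close>

lemma lp2_optimal_endpoint:
  fixes V :: "'a::finite set"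
  assumes opt: "lp2_optimal_extreme \<epsilon> V E f C (y, z)" and "\<epsilon> > 0"
    and graph: "simple_graph V E" and e: "e \<in> E" and pos: "y $ e > 0"
  obtains u v where "e = {u, v}" "f v > 0" "z $ v = 0"
proof -
  have feas: "(y, z) \<in> lp2_feasible V E f C"
    using opt by (simp add: lp2_optimal_extreme_def extreme_point_of_def)
  have y0: "0 \<le> y $ d" for d using feas by (cases "d \<in> E") (auto simp: lp2_feasible_iff)
  obtain a b where ab: "e = {a, b}" "a \<noteq> b"
    using graph e by (metis card_2_iff simple_graph_def)
  have abV: "a \<in> V" "b \<in> V" using graph e ab by (auto simp: simple_graph_def)
  \<comment> \<open>Without slack, \<open>f v\<close> alone bounds an edge sum that contains the
    positive value \<open>y $ e\<close>.\<close>
  have f: "f v > 0" if v: "v \<in> e" "z $ v = 0" for v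
  proof -
    have "y $ e \<le> (\<Sum>d\<in>incident E v. y $ d)"
      using e v y0 by (intro member_le_sum) (auto simp: incident_def)
    also have "\<dots> \<le> real (f v)"
    proof -
      have "v \<in> V" using v(1) abV ab(1) by blast
      then have "(\<Sum>d\<in>incident E v. y $ d) \<le> real (f v) + (if v \<in> C then 0 else z $ v)"
        using feas by (simp add: lp2_feasible_iff)
      then show ?thesis using v(2) by (simp split: if_splits)
    qed
    finally show ?thesis using pos by linarith
  qed
  have "z $ a = 0 \<or> z $ b = 0"
  proof (rule ccontr)
    assume "\<not> (z $ a = 0 \<or> z $ b = 0)"
    then have z: "z $ a > 0" "z $ b > 0"
      using feas abV unfolding lp2_feasible_iff by (simp_all add: less_le)
    \<comment> \<open>The largest decrease that keeps \<open>y $ e\<close> and both slacks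
      nonnegative.\<close>
    define s where "s = min (y $ e) (min (z $ a) (z $ b))"
    have s: "s > 0" "s \<le> y $ e" "s \<le> z $ a" "s \<le> z $ b" using z pos by (auto simp: s_def)
    define y' where "y' = y - axis e s"
    define z' where "z' = z - axis a s - axis b s"
    have sum': "(\<Sum>d\<in>A. y' $ d) = (\<Sum>d\<in>A. y $ d) - (if e \<in> A then s else 0)" for A
      by (simp add: y'_def axis_def sum_subtractf)
    have zz: "z' $ v = z $ v - (if v \<in> e then s else 0)" for v
      using ab by (auto simp: z'_def axis_def)
    have yy: "y' $ d = y $ d - (if d = e then s else 0)" for d
      by (auto simp: y'_def axis_def)
    have "(y', z') \<in> lp2_feasible V E f C"
      unfolding lp2_feasible_iff sum' zz yy
    proof (intro conjI ballI allI impI)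
      fix v assume v: "v \<in> V - C"
      then have "(\<Sum>d\<in>incident E v. y $ d) \<le> real (f v) + z $ v"
        using feas by (simp add: lp2_feasible_iff)
      then show "(\<Sum>d\<in>incident E v. y $ d) - (if e \<in> incident E v then s else 0)
          \<le> real (f v) + (z $ v - (if v \<in> e then s else 0))"
        using e by (simp add: incident_def)
    next
      fix v assume v: "v \<in> V \<inter> C"
      then have "(\<Sum>d\<in>incident E v. y $ d) \<le> real (f v)"
        using feas by (simp add: lp2_feasible_iff)
      then show "(\<Sum>d\<in>incident E v. y $ d) - (if e \<in> incident E v then s else 0) \<le> real (f v)"
        using s(1) by simp
    next
      fix v assume "v \<in> V"
      then have "0 \<le> z $ v" using feas by (simp add: lp2_feasible_iff)
      then show "0 \<le> z $ v - (if v \<in> e then s else 0)" using s ab(1) by auto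
    next
      fix d assume "d \<in> E"
      then have "0 \<le> y $ d" "y $ d \<le> 1" using feas by (simp_all add: lp2_feasible_iff)
      then show "0 \<le> y $ d - (if d = e then s else 0)" "y $ d - (if d = e then s else 0) \<le> 1"
        using s by auto
    next
      fix d assume "d \<notin> E"
      then show "y $ d - (if d = e then s else 0) = 0" using feas e by (auto simp: lp2_feasible_iff)
    next
      fix v assume "v \<notin> V"
      then show "z $ v - (if v \<in> e then s else 0) = 0"
        using feas abV ab(1) by (auto simp: lp2_feasible_iff)
    qed
    then have "lp2_objective \<epsilon> V E (y', z') \<le> lp2_objective \<epsilon> V E (y, z)"
      using opt by (simp add: lp2_optimal_extreme_def)
    moreover have "(\<Sum>v\<in>V. z' $ v) = (\<Sum>v\<in>V. z $ v) - 2 * s"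
      using ab abV by (simp add: z'_def axis_def sum_subtractf)
    \<comment> \<open>The shift changes the objective by
      \<open>2 * (1 + \<epsilon>) * s - 2 * s\<close>, which optimality forbids to be
      positive.\<close>
    ultimately have "2 * s * \<epsilon> \<le> 0"
      using e by (simp add: lp2_objective_def sum' algebra_simps)
    then show False using s \<open>\<epsilon> > 0\<close> by (simp add: mult_le_0_iff)
  qed
  then show thesis
    using that[of a b] that[of b a] f ab by (auto simp: insert_commute)
qed

section \<open>Runs of the procedure\<close>

text \<open>Each call removes one edge, whence the induction on \<open>card E\<close>. If no edge
  has value 0, extremality supplies an edge of value at least 1/2 and optimality a suitable naming
  of its endpoints.\<close>

lemma solveIP2_exists:
  fixes V :: "'a::finite set"
  assumes "simple_graph V E" "\<epsilon> > 0"
  shows "\<exists>S. solveIP2 \<epsilon> V E C f S"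
  using assms(1)
proof (induction "card E" arbitrary: V E C f rule: less_induct)
  case less
  show ?case
  proof (cases "E = {}")
    case True
    then show ?thesis using solveIP2.empty by blast
  next
    case False
    let ?W = "non_isolated V E"
    obtain y z where opt: "lp2_optimal_extreme \<epsilon> ?W E f C (y, z)"
      using lp2_optimal_extreme_exists[of \<epsilon> ?W E f C] \<open>\<epsilon> > 0\<close> by fastforce
    have graph: "simple_graph ?W E"
      using simple_graph_non_isolated[OF less.prems] by blast
    have rec: "\<exists>S. solveIP2 \<epsilon> ?W (E - {e}) C' f' S" if "e \<in> E" for e C' f'
      using that simple_graph_non_isolated[OF less.prems]
      by (intro less.hyps) (auto intro: card_Diff1_less simp del: card_Diff_insert)
    show ?thesis
    proof (cases "\<exists>e\<in>E. y $ e = 0")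
      case True
      then obtain e where e: "e \<in> E" "y $ e = 0" by blast
      obtain S where "solveIP2 \<epsilon> ?W (E - {e}) C f S" using rec[OF e(1)] by blast
      then show ?thesis using solveIP2.delete[OF False refl opt e] by blast
    next
      case no_zero: False
      then have nz: "\<forall>e\<in>E. y $ e \<noteq> 0" by blast
      have ext: "(y, z) extreme_point_of lp2_feasible ?W E f C"
        using opt by (simp add: lp2_optimal_extreme_def)
      have cover: "\<forall>v\<in>?W. incident E v \<noteq> {}" by (simp add: non_isolated_def)
      obtain e where e: "e \<in> E" "y $ e \<ge> 1 / 2"
        using lp2_extreme_half_edge[OF ext nz graph False cover] by blast
      then have "y $ e > 0" by linarith
      then obtain u v where uv: "e = {u, v}" "f v > 0" "z $ v = 0"
        by (rule lp2_optimal_endpoint[OF opt \<open>\<epsilon> > 0\<close> graph e(1)])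
      obtain S where
        "solveIP2 \<epsilon> ?W (E - {e}) (insert v C) (f(v := f v - 1, u := f u - 1)) S"
        using rec[OF e(1)] by blast
      then show ?thesis
        using solveIP2.pick[OF False refl opt nz e(1) uv(1) e(2) uv(2,3)] by blast
    qed
  qed
qed

section \<open>Feasibility of the output\<close>

lemma degree_insert:
  fixes S :: "'a::finite set set"
  assumes "e \<notin> S"
  shows "degree (insert e S) w = degree S w + (if w \<in> e then 1 else 0)"
proof -
  have "incident (insert e S) w = (if w \<in> e then insert e (incident S w) else incident S w)"
    by (auto simp: incident_def)
  then show ?thesis using assms by (simp add: degree_def incident_def)
qed

text \<open>The bound on all of \<open>C\<close> is what drives the induction: picking an edge puts
  \<open>v\<close> into \<open>C\<close>, so \<open>v\<close> stays within its remaining bound and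
  certifies that edge.\<close>

lemma solveIP2_output:
  fixes V :: "'a::finite set"
  assumes "solveIP2 \<epsilon> V E C f S" "simple_graph V E"
  shows "S \<subseteq> E \<and> (\<forall>w\<in>C. degree S w \<le> f w) \<and> (\<forall>d\<in>S. \<exists>w\<in>d. degree S w \<le> f w)"
  using assms
proof (induction rule: solveIP2.induct)
  case (empty V C f)
  then show ?case by (simp add: degree_def incident_def)
next
  case (delete E W V f C y z e S)
  have "simple_graph W (E - {e})"
    using simple_graph_non_isolated[OF delete.prems] delete.hyps(2) by blast
  then show ?case using delete.IH by blast
next
  case (pick E W V f C y z e u v S)
  have "simple_graph W (E - {e})"
    using simple_graph_non_isolated[OF pick.prems] pick.hyps(2) by blast
  note IH = pick.IH[OF this]
  have SE: "S \<subseteq> E - {e}" using IH by (rule conjunct1)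
  have IH_C: "degree S w \<le> (f(v := f v - 1, u := f u - 1)) w" if "w \<in> insert v C" for w
    using conjunct1[OF conjunct2[OF IH]] that by (rule bspec)
  have IH_S: "\<exists>w\<in>d. degree S w \<le> (f(v := f v - 1, u := f u - 1)) w" if "d \<in> S" for d
    using conjunct2[OF conjunct2[OF IH]] that by (rule bspec)
  have card: "card e = 2" using pick.prems pick.hyps by (simp add: simple_graph_def)
  then have uv: "u \<noteq> v" using pick.hyps by auto
  have eS: "e \<notin> S" using SE by auto
  have uW: "u \<in> W"
    using pick.prems pick.hyps by (auto simp: simple_graph_def non_isolated_def incident_def)
  have feas: "(y, z) \<in> lp2_feasible W E f C"
    using pick.hyps(3) by (simp add: lp2_optimal_extreme_def extreme_point_of_def)
  \<comment> \<open>A vertex of \<open>C\<close> has no slack, so \<open>y $ e \<ge> 1 / 2\<close>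
    forces a positive bound.\<close>
  have uC: "0 < f u" if "u \<in> C"
  proof -
    have "y $ e \<le> (\<Sum>d\<in>incident E u. y $ d)"
      using feas pick.hyps by (intro member_le_sum) (auto simp: incident_def lp2_feasible_iff)
    also have "\<dots> \<le> real (f u)" using feas that uW by (simp add: lp2_feasible_iff)
    finally show ?thesis using pick.hyps by linarith
  qed
  have we: "w \<in> e \<longleftrightarrow> w = u \<or> w = v" for w using pick.hyps(6) by blast
  \<comment> \<open>The decrement of the bound pays for the new edge; this could fail only at
    \<open>u\<close> when \<open>f u = 0\<close>, where subtraction truncates.\<close>
  have step: "degree (insert e S) w \<le> f w"
    if "degree S w \<le> (f(v := f v - 1, u := f u - 1)) w" "w = u \<Longrightarrow> 0 < f u" for w
  proof -
    consider "w = u" | "w = v" | "w \<noteq> u" "w \<noteq> v" by blast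
    then show ?thesis
      using that uv we \<open>0 < f v\<close> by cases (simp_all add: degree_insert[OF eS])
  qed
  have v: "degree (insert e S) v \<le> f v"
    by (rule step) (use IH_C[of v] uv in auto)
  have S_ok: "\<exists>w\<in>d. degree (insert e S) w \<le> f w" if d: "d \<in> S" for d
  proof -
    obtain w where w: "w \<in> d" "degree S w \<le> (f(v := f v - 1, u := f u - 1)) w"
      using IH_S[OF d] by (rule bexE)
    \<comment> \<open>A certifying vertex lies on an edge of \<open>S\<close>, so its lowered bound
      is positive and truncation did not occur.\<close>
    have "degree S w \<noteq> 0" using d w(1) by (auto simp: degree_def incident_def)
    then have "degree (insert e S) w \<le> f w"
      by (intro step[OF w(2)]) (use w(2) in simp)
    then show ?thesis using w(1) by (rule bexI)
  qed
  have C_ok: "degree (insert e S) w \<le> f w" if "w \<in> C" for w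
    using that uC by (intro step IH_C) auto
  have e_ok: "\<exists>w\<in>e. degree (insert e S) w \<le> f w"
    using v by (rule bexI) (simp add: we)
  have "insert e S \<subseteq> E" using SE pick.hyps(5) by blast
  moreover have "\<exists>w\<in>d. degree (insert e S) w \<le> f w" if "d \<in> insert e S" for d
    using insertE[OF that] e_ok S_ok by metis
  ultimately show ?case using C_ok by (intro conjI ballI)
qed

section \<open>LP values: loss along a run, and comparison with feasible edge sets\<close>

text \<open>Repairs one violated bound by scaling the values on \<open>A\<close> with
  \<open>b / sum y A\<close>. The total drops only by the excess, and since no value grows, other
  upper bounds persist.\<close>

lemma scale_down_sum:
  fixes y :: "'b \<Rightarrow> real"
  assumes "finite E" "A \<subseteq> E" "\<forall>e. 0 \<le> y e" "sum y A \<le> b + \<delta>" "0 \<le> b" "0 \<le> \<delta>"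
  obtains y' where "\<And>e. 0 \<le> y' e" "\<And>e. y' e \<le> y e" "sum y' A \<le> b" "sum y E \<le> sum y' E + \<delta>"
proof (cases "sum y A \<le> b")
  case True
  then show ?thesis using that[of y] assms by simp
next
  case False
  define r where "r = b / sum y A"
  have r: "0 \<le> r" "r \<le> 1" "r * sum y A = b"
    using False assms by (auto simp: r_def divide_le_eq_1)
  define y' where "y' e = (if e \<in> A then r * y e else y e)" for e
  have A: "sum y' A = b" using r by (simp add: y'_def sum_distrib_left[symmetric])
  have "sum y E = sum y A + sum y (E - A)" "sum y' E = sum y' A + sum y' (E - A)"
    using sum.subset_diff[OF assms(2,1)] by (simp_all add: add.commute)
  moreover have "sum y' (E - A) = sum y (E - A)" by (simp add: y'_def)
  ultimately show ?thesis
    using that[of y'] A assms r by (auto simp: y'_def mult_left_le_one_le)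
qed

text \<open>Dropping \<open>e\<close> costs \<open>2 y\<^sub>e\<close>, and restoring the degree bounds at each of its endpoints costs
  at most \<open>2 (1 - y\<^sub>e)\<close>; the total is \<open>4 - 2 y\<^sub>e \<le> 3\<close>.\<close>

lemma lp2_pick_loss:
  fixes V :: "'a::finite set"
  assumes feas: "(y, z) \<in> lp2_feasible V E f C"
    and e: "{u, v} \<in> E" "u \<noteq> v" "u \<in> V" "v \<in> V" "y $ {u, v} \<ge> 1 / 2" and v: "f v > 0" "z $ v = 0"
  obtains q where
    "q \<in> lp2_feasible V (E - {{u, v}}) (f(v := f v - 1, u := f u - 1)) (insert v C)"
    "lp2_objective \<epsilon> V E (y, z) \<le> lp2_objective \<epsilon> V (E - {{u, v}}) q + 3"
proof -
  let ?e = "{u, v}"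
  let ?D = "E - {?e}" and ?f = "f(v := f v - 1, u := f u - 1)"
  \<comment> \<open>The usable slack; it merges the degree constraints inside and outside
    \<open>C\<close> into one.\<close>
  define g where "g w = (if w \<in> C then 0 else z $ w)" for w
  have y01: "0 \<le> y $ d" "y $ d \<le> 1" for d
    using feas by (cases "d \<in> E"; auto simp: lp2_feasible_iff)+
  have z0: "0 \<le> z $ w" for w using feas by (cases "w \<in> V") (auto simp: lp2_feasible_iff)
  have bound: "(\<Sum>d\<in>incident E w. y $ d) \<le> real (f w) + g w" if "w \<in> V" for w
    using feas that by (auto simp: lp2_feasible_iff g_def)
  define Y where "Y d = (if d = ?e then 0 else y $ d)" for d
  have Y0: "0 \<le> Y d" "Y d \<le> y $ d" for d using y01 by (auto simp: Y_def)
  have Y_inc: "sum Y (incident ?D w) = (\<Sum>d\<in>incident E w. y $ d) - (if w \<in> ?e then y $ ?e else 0)" for w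
  proof -
    have "sum Y (incident ?D w) = (\<Sum>d\<in>incident E w - {?e}. y $ d)"
      unfolding incident_remove_edge by (intro sum.cong) (auto simp: Y_def)
    also have "\<dots> = (\<Sum>d\<in>incident E w. y $ d) - (if ?e \<in> incident E w then y $ ?e else 0)"
      by (simp add: sum_diff1)
    finally show ?thesis using e(1) by (simp add: incident_def)
  qed
  have Y_E: "sum Y ?D = (\<Sum>d\<in>E. y $ d) - y $ ?e"
    using e(1) by (simp add: Y_def sum_diff1)
  obtain Y1 where Y1: "\<And>d. 0 \<le> Y1 d" "\<And>d. Y1 d \<le> Y d" "sum Y1 (incident ?D v) \<le> real (f v) - 1"
    "sum Y ?D \<le> sum Y1 ?D + (1 - y $ ?e)"
  proof (rule scale_down_sum[of ?D "incident ?D v" Y "real (f v) - 1" "1 - y $ ?e"])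
    \<comment> \<open>Since \<open>z $ v = 0\<close>, the load at \<open>v\<close> without
      \<open>?e\<close> is at most \<open>f v - y $ ?e\<close>, so it exceeds the new bound by at
      most \<open>1 - y $ ?e\<close>.\<close>
    show "sum Y (incident ?D v) \<le> real (f v) - 1 + (1 - y $ ?e)"
      using bound[OF e(4)] v(2) by (simp add: Y_inc g_def split: if_splits)
  qed (use v(1) y01 Y0 incident_subset[of ?D] in auto)
  have mono1: "sum Y1 (incident ?D w) \<le> sum Y (incident ?D w)" for w
    using Y1 by (intro sum_mono) auto
  obtain Y2 where Y2: "\<And>d. 0 \<le> Y2 d" "\<And>d. Y2 d \<le> Y1 d"
    "sum Y2 (incident ?D u) \<le> real (f u - 1) + g u"
    "sum Y1 ?D \<le> sum Y2 ?D + (1 - y $ ?e)"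
  proof (rule scale_down_sum[of ?D "incident ?D u" Y1 "real (f u - 1) + g u" "1 - y $ ?e"])
    \<comment> \<open>Truncated subtraction lowers the bound by at most 1, also when
      \<open>f u = 0\<close>.\<close>
    have "real (f u) \<le> real (f u - 1) + 1" by linarith
    then show "sum Y1 (incident ?D u) \<le> real (f u - 1) + g u + (1 - y $ ?e)"
      using bound[OF e(3)] mono1[of u] by (simp add: Y_inc)
  qed (use Y1 y01 z0 incident_subset[of ?D] in \<open>auto simp: g_def\<close>)
  have mono2: "sum Y2 (incident ?D w) \<le> sum Y1 (incident ?D w)" for w
    using Y2 by (intro sum_mono) auto
  have Y2y: "Y2 d \<le> Y d" for d using Y2(2)[of d] Y1(2)[of d] by simp
  \<comment> \<open>The second scaling only lowers values, so the bound restored at \<open>v\<close>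
    persists; \<open>v\<close> gets no slack because it joins \<open>C\<close>.\<close>
  have deg: "sum Y2 (incident ?D w) \<le> real (?f w) + (if w = v then 0 else g w)" if "w \<in> V" for w
  proof -
    consider "w = v" | "w = u" | "w \<noteq> u" "w \<noteq> v" by blast
    then show ?thesis
    proof cases
      case 1
      then show ?thesis using mono2[of v] Y1(3) e(2) v(1) by (simp add: of_nat_diff)
    next
      case 2
      then show ?thesis using Y2(3) e(2) by simp
    next
      case 3
      then show ?thesis using mono2[of w] mono1[of w] bound[OF that] by (simp add: Y_inc)
    qed
  qed
  have Y2_1: "Y2 d \<le> 1" for d using Y2y[of d] Y0(2)[of d] y01(2)[of d] by linarith
  have Y2_0: "Y2 d = 0" if "d \<notin> ?D" for d
  proof -
    have "Y d = 0" using that feas by (auto simp: Y_def lp2_feasible_iff)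
    then show ?thesis using Y2(1)[of d] Y2y[of d] by simp
  qed
  have zV: "z $ w = 0" if "w \<notin> V" for w using feas that by (simp add: lp2_feasible_iff)
  have "((\<chi> d. Y2 d), z) \<in> lp2_feasible V ?D ?f (insert v C)"
    unfolding lp2_feasible_iff vec_lambda_beta
  proof (intro conjI ballI allI impI)
    fix w assume "w \<in> V - insert v C"
    then show "sum Y2 (incident ?D w) \<le> real (?f w) + z $ w"
      using deg[of w] by (simp add: g_def del: fun_upd_apply)
  next
    fix w assume "w \<in> V \<inter> insert v C"
    then show "sum Y2 (incident ?D w) \<le> real (?f w)"
      using deg[of w] by (auto simp add: g_def simp del: fun_upd_apply split: if_splits)
  qed (simp_all add: z0 zV Y2(1) Y2_1 Y2_0 del: Diff_iff)
  moreover have "lp2_objective \<epsilon> V E (y, z) \<le> lp2_objective \<epsilon> V ?D ((\<chi> d. Y2 d), z) + 3"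
    using Y_E Y1(4) Y2(4) e(5) unfolding lp2_objective_def by simp
  ultimately show thesis by (rule that)
qed

text \<open>Isolated vertices carry no load, so discarding their slacks only saves cost.\<close>

lemma lp2_objective_non_isolated:
  fixes V :: "'a::finite set"
  assumes q: "q \<in> lp2_feasible V E f C" and "\<epsilon> > 0"
  obtains q' where "q' \<in> lp2_feasible (non_isolated V E) E f C"
    "lp2_objective \<epsilon> V E q \<le> lp2_objective \<epsilon> (non_isolated V E) E q'"
proof -
  let ?W = "non_isolated V E"
  have W: "?W \<subseteq> V" by (auto simp: non_isolated_def)
  obtain y z where yz: "q = (y, z)" by (cases q)
  define z' where "z' = (\<chi> v. if v \<in> ?W then z $ v else 0)"
  have "(y, z') \<in> lp2_feasible ?W E f C"
    using q W by (auto simp: yz lp2_feasible_iff z'_def)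
  moreover have "(\<Sum>v\<in>?W. z' $ v) \<le> (\<Sum>v\<in>V. z $ v)"
  proof -
    have "(\<Sum>v\<in>?W. z' $ v) = (\<Sum>v\<in>?W. z $ v)" by (simp add: z'_def)
    also have "\<dots> \<le> (\<Sum>v\<in>V. z $ v)"
      using W q by (intro sum_mono2) (auto simp: yz lp2_feasible_iff)
    finally show ?thesis .
  qed
  ultimately show thesis using that \<open>\<epsilon> > 0\<close> by (simp add: yz lp2_objective_def)
qed

text \<open>Speaking of every feasible \<open>q\<close>, not just an optimal one, lets the induction
  hypothesis apply to the point built from the current optimum for the next call.\<close>

lemma solveIP2_lp_bound:
  fixes V :: "'a::finite set"
  assumes "solveIP2 \<epsilon> V E C f S" "simple_graph V E" "\<epsilon> > 0" "q \<in> lp2_feasible V E f C"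
  shows "lp2_objective \<epsilon> V E q \<le> 3 * real (card S)"
  using assms(1,2,4)
proof (induction arbitrary: q rule: solveIP2.induct)
  case (empty V C f)
  then show ?case using \<open>\<epsilon> > 0\<close>
    by (cases q) (auto simp: lp2_objective_def lp2_feasible_iff intro!: mult_nonneg_nonneg sum_nonneg)
next
  case (delete E W V f C y z e S)
  have graph: "simple_graph W (E - {e})"
    using simple_graph_non_isolated[OF delete.prems(1)] delete.hyps(2) by blast
  have feas: "(y, z) \<in> lp2_feasible W E f C"
    using delete.hyps(3) by (simp add: lp2_optimal_extreme_def extreme_point_of_def)
  have sum_eq: "(\<Sum>d\<in>A - {e}. y $ d) = (\<Sum>d\<in>A. y $ d)" for A
    using delete.hyps(5) by (simp add: sum_diff1)
  have feas': "(y, z) \<in> lp2_feasible W (E - {e}) f C"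
    using feas delete.hyps(5) by (auto simp: lp2_feasible_iff incident_remove_edge sum_eq)
  have "lp2_objective \<epsilon> V E q \<le> lp2_objective \<epsilon> W E (y, z)"
    using lp2_objective_non_isolated[OF delete.prems(2) \<open>\<epsilon> > 0\<close>] delete.hyps(2,3)
    by (metis lp2_optimal_extreme_def order_trans)
  also have "\<dots> = lp2_objective \<epsilon> W (E - {e}) (y, z)" by (simp add: lp2_objective_def sum_eq)
  also have "\<dots> \<le> 3 * real (card S)" by (rule delete.IH[OF graph feas'])
  finally show ?case .
next
  case (pick E W V f C y z e u v S)
  have graph: "simple_graph W (E - {e})" "simple_graph W E"
    using simple_graph_non_isolated[OF pick.prems(1)] pick.hyps(2) by blast+
  \<comment> \<open>The picked edge is new to \<open>S\<close>, so each loss of 3 is matched by one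
    more output edge.\<close>
  have "S \<subseteq> E - {e}" using solveIP2_output[OF pick.hyps(10) graph(1)] by blast
  then have card: "card (insert e S) = card S + 1" by (subst card_insert_disjoint) auto
  have feas: "(y, z) \<in> lp2_feasible W E f C"
    using pick.hyps(3) by (simp add: lp2_optimal_extreme_def extreme_point_of_def)
  have uv: "card {u, v} = 2" "{u, v} \<subseteq> W"
    using graph(2) pick.hyps(5,6) by (auto simp: simple_graph_def)
  then have uv: "u \<noteq> v" "u \<in> W" "v \<in> W" by auto
  obtain q' where q': "q' \<in> lp2_feasible W (E - {e}) (f(v := f v - 1, u := f u - 1)) (insert v C)"
    "lp2_objective \<epsilon> W E (y, z) \<le> lp2_objective \<epsilon> W (E - {e}) q' + 3"
    using lp2_pick_loss[OF feas _ uv] pick.hyps(5-9) by metis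
  have "lp2_objective \<epsilon> V E q \<le> lp2_objective \<epsilon> W E (y, z)"
    using lp2_objective_non_isolated[OF pick.prems(2) \<open>\<epsilon> > 0\<close>] pick.hyps(2,3)
    by (metis lp2_optimal_extreme_def order_trans)
  also note q'(2)
  also have "lp2_objective \<epsilon> W (E - {e}) q' \<le> 3 * real (card S)"
    by (rule pick.IH[OF graph(1) q'(1)])
  finally show ?case using card by simp
qed

text \<open>The vertices whose bound is violated by \<open>F\<close> are independent in \<open>F\<close>, so their degrees sum
  to at most \<open>card F\<close>.\<close>

lemma pdbep_feasible_lp2:
  fixes V :: "'a::finite set"
  assumes graph: "simple_graph V E" and F: "pdbep_feasible E c F" and "\<epsilon> > 0"
  obtains q where "q \<in> lp2_feasible V E c {}" "(1 - \<epsilon>) * real (card F) \<le> lp2_objective \<epsilon> V E q"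
proof -
  have FE: "F \<subseteq> E" using F by (simp add: pdbep_feasible_def)
  define y :: "real ^ 'a set" where "y = (\<chi> e. if e \<in> F then 1 else 0)"
  \<comment> \<open>Truncated subtraction makes this the degree excess, 0 where the bound is
    respected.\<close>
  define z :: "real ^ 'a" where "z = (\<chi> v. if v \<in> V then real (degree F v - c v) else 0)"
  have inc: "incident E v \<inter> F = incident F v" for v using FE by (auto simp: incident_def)
  have sum_y: "(\<Sum>e\<in>A. y $ e) = real (card (A \<inter> F))" for A by (simp add: y_def sum.If_cases)
  have "(y, z) \<in> lp2_feasible V E c {}"
    unfolding lp2_feasible_iff sum_y inc using FE
    by (auto simp: y_def z_def degree_def)
  moreover have "(1 - \<epsilon>) * real (card F) \<le> lp2_objective \<epsilon> V E (y, z)"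
  proof -
    define B where "B = {v\<in>V. c v < degree F v}"
    have indep: "card (e \<inter> B) \<le> 1" if "e \<in> F" for e
    proof -
      have "card e = 2" using that graph FE by (auto simp: simple_graph_def)
      then obtain a b where ab: "e = {a, b}" by (auto simp: card_2_iff)
      then have "a \<notin> B \<or> b \<notin> B"
        using F that by (force simp: pdbep_feasible_def B_def not_less)
      then have "e \<inter> B \<subseteq> {b} \<or> e \<inter> B \<subseteq> {a}" using ab by auto
      then show ?thesis using card_mono[of "{a}" "e \<inter> B"] card_mono[of "{b}" "e \<inter> B"] by auto
    qed
    have "(\<Sum>v\<in>V. degree F v - c v) = (\<Sum>v\<in>B. degree F v - c v)"
      by (rule sum.mono_neutral_right) (auto simp: B_def)
    also have "\<dots> \<le> (\<Sum>v\<in>B. degree F v)" by (intro sum_mono) auto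
    also have "\<dots> = (\<Sum>e\<in>F. card (e \<inter> B))" by (rule sum_degree)
    also have "\<dots> \<le> card F" using sum_mono[OF indep, of F] by simp
    finally have "(\<Sum>v\<in>V. z $ v) \<le> real (card F)"
      unfolding z_def by (simp flip: of_nat_sum)
    then have "(1 + \<epsilon>) * (\<Sum>v\<in>V. z $ v) \<le> (1 + \<epsilon>) * real (card F)"
      using \<open>\<epsilon> > 0\<close> by (intro mult_left_mono) auto
    moreover have "(\<Sum>e\<in>E. y $ e) = real (card F)"
      using FE by (simp add: sum_y Int_absorb1)
    \<comment> \<open>The value is at least \<open>2 |F| - (1 + \<epsilon>) |F|\<close>.\<close>
    ultimately show ?thesis by (simp add: lp2_objective_def algebra_simps)
  qed
  ultimately show thesis by (rule that)
qed

lemma pdbep_opt_attained: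
  fixes E :: "'a::finite set set"
  obtains F where "pdbep_feasible E c F" "pdbep_opt E c = card F"
proof -
  let ?M = "{card F | F. pdbep_feasible E c F}"
  have "finite ?M" by simp
  moreover have "pdbep_feasible E c {}" by (simp add: pdbep_feasible_def)
  then have "?M \<noteq> {}" by blast
  ultimately have "pdbep_opt E c \<in> ?M" unfolding pdbep_opt_def by (rule Max_in)
  then show thesis using that by blast
qed

theorem theorem3:
  fixes V :: "'a::finite set" and E :: "'a set set" and c :: "'a \<Rightarrow> nat" and \<epsilon> :: real
  assumes "connected_graph V E" and "0 < \<epsilon>" and "\<epsilon> < 1"
  shows "(\<exists>E'. solveIP2 \<epsilon> V E {} c E') \<and>
    (\<forall>E'. solveIP2 \<epsilon> V E {} c E' \<longrightarrow>
       pdbep_feasible E c E' \<and>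
       real (pdbep_opt E c) \<le> 3 / (1 - \<epsilon>)\<^sup>2 * real (card E'))"
proof (intro conjI allI impI)
  have graph: "simple_graph V E" using assms(1) by (simp add: connected_graph_def)
  show "\<exists>E'. solveIP2 \<epsilon> V E {} c E'" using solveIP2_exists[OF graph assms(2)] .
  fix S assume S: "solveIP2 \<epsilon> V E {} c S"
  show "pdbep_feasible E c S"
    using solveIP2_output[OF S graph] by (fastforce simp: pdbep_feasible_def)
  obtain F where F: "pdbep_feasible E c F" "pdbep_opt E c = card F"
    by (rule pdbep_opt_attained)
  obtain q where q: "q \<in> lp2_feasible V E c {}"
    "(1 - \<epsilon>) * real (card F) \<le> lp2_objective \<epsilon> V E q"
    using pdbep_feasible_lp2[OF graph F(1) assms(2)] .
  \<comment> \<open>The LP comparison yields the factor \<open>3 / (1 - \<epsilon>)\<close>; as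
    \<open>1 - \<epsilon>\<close> lies between 0 and 1, squaring it only weakens the bound.\<close>
  have "(1 - \<epsilon>)\<^sup>2 * real (card F) \<le> (1 - \<epsilon>) * real (card F)"
    using assms(2,3) by (intro mult_right_mono) (auto simp: power2_eq_square mult_left_le)
  also have "\<dots> \<le> 3 * real (card S)"
    using q solveIP2_lp_bound[OF S graph assms(2) q(1)] by linarith
  finally show "real (pdbep_opt E c) \<le> 3 / (1 - \<epsilon>)\<^sup>2 * real (card S)"
    using F(2) assms(3) by (simp add: field_simps)
qed

end
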